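(* Let $n\ge 2$, let $P=(p_1,\dots,p_n)$ and $Q=(q_1,\dots,q_n)$ be elements of $\Gamma_n$, and let $r,R$ be real numbers with $0<r\le \frac{p_i}{q_i}\le R<\infty$ for all $i\in\{1,\dots,n\}$. Then $$\frac{2}{1+R^2}\,T(P\|Q)\le G(P\|Q)\le \frac{2}{1+r^2}\,T(P\|Q).$$
   Context: $\Gamma_n=\{P=(p_1,\dots,p_n): p_i>0,\ \sum_{i=1}^n p_i=1\}$ is the set of finite discrete probability distributions with strictly positive entries. $\ln$ is the natural logarithm. The relative arithmetic-geometric divergence is $G(P\|Q)=\sum_{i=1}^n \left(\frac{p_i+q_i}{2}\right)\ln\left(\frac{p_i+q_i}{2p_i}\right)$. The arithmetic-geometric divergence is $T(P\|Q)=\sum_{i=1}^n \left(\frac{p_i+q_i}{2}\right)\ln\left(\frac{p_i+q_i}{2\sqrt{p_iq_i}}\right)$. *)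

theory Defs
  imports "HOL-Analysis.Analysis"
begin

text \<open>The open simplex \<open>\<Gamma>\<^sub>n\<close>, where n is the cardinality of the index type.\<close>

definition prob_simplex :: "(real ^ 'n) set" where
  "prob_simplex = {P. (\<forall>i. P $ i > 0) \<and> (\<Sum>i\<in>UNIV. P $ i) = 1}"

definition rel_AG_divergence :: "real ^ 'n \<Rightarrow> real ^ 'n \<Rightarrow> real" where
  "rel_AG_divergence P Q =
     (\<Sum>i\<in>UNIV. ((P $ i + Q $ i) / 2) * ln ((P $ i + Q $ i) / (2 * P $ i)))"

definition AG_divergence :: "real ^ 'n \<Rightarrow> real ^ 'n \<Rightarrow> real" where
  "AG_divergence P Q =
     (\<Sum>i\<in>UNIV. ((P $ i + Q $ i) / 2) * ln ((P $ i + Q $ i) / (2 * sqrt (P $ i * Q $ i))))"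

end

theory Submission
  imports Defs
begin

text \<open>
  Both divergences have the form \<open>\<Sum>i. q\<^sub>i * f (p\<^sub>i / q\<^sub>i)\<close> with \<open>f 1 = 0\<close>, and the second derivatives
  of the two generating functions are \<open>1 / (2x\<^sup>2(x+1))\<close> and \<open>(1+x\<^sup>2) / (4x\<^sup>2(x+1))\<close>. Their ratio
  \<open>2 / (1+x\<^sup>2)\<close> lies between \<open>2 / (1+R\<^sup>2)\<close> and \<open>2 / (1+r\<^sup>2)\<close> on \<open>[r, R]\<close>, so the differences to be
  compared are generated by functions that are convex there, and Jensen's inequality applies.
\<close>

text \<open>For \<open>x > 0\<close> the bracket is \<open>ln ((x + 1) / (2 * x))\<close>; splitting
  the logarithm keeps differentiation elementary.\<close>

definition rel_AG_gen :: "real \<Rightarrow> real" where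
  "rel_AG_gen x = (x + 1) / 2 * (ln (x + 1) - ln 2 - ln x)"

text \<open>Likewise, the bracket is \<open>ln ((x + 1) / (2 * sqrt x))\<close> for
  \<open>x > 0\<close>.\<close>

definition AG_gen :: "real \<Rightarrow> real" where
  "AG_gen x = (x + 1) / 2 * (ln (x + 1) - ln 2 - ln x / 2)"

lemma rel_AG_divergence_eq_gen:
  assumes "P \<in> prob_simplex" "Q \<in> prob_simplex"
  shows "rel_AG_divergence P Q = (\<Sum>i\<in>UNIV. Q $ i * rel_AG_gen (P $ i / Q $ i))"
  unfolding rel_AG_divergence_def
proof (rule sum.cong)
  fix i
  have p: "P $ i > 0" and q: "Q $ i > 0"
    using assms by (auto simp: prob_simplex_def)
  have "P $ i / Q $ i + 1 = (P $ i + Q $ i) / Q $ i"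
    using q by (simp add: field_simps)
  then show "(P $ i + Q $ i) / 2 * ln ((P $ i + Q $ i) / (2 * P $ i)) =
      Q $ i * rel_AG_gen (P $ i / Q $ i)"
    using p q by (simp add: rel_AG_gen_def ln_div ln_mult)
qed simp

lemma AG_divergence_eq_gen:
  assumes "P \<in> prob_simplex" "Q \<in> prob_simplex"
  shows "AG_divergence P Q = (\<Sum>i\<in>UNIV. Q $ i * AG_gen (P $ i / Q $ i))"
  unfolding AG_divergence_def
proof (rule sum.cong)
  fix i
  have p: "P $ i > 0" and q: "Q $ i > 0"
    using assms by (auto simp: prob_simplex_def)
  have "P $ i / Q $ i + 1 = (P $ i + Q $ i) / Q $ i"
    using q by (simp add: field_simps)
  moreover have "ln ((P $ i + Q $ i) / (2 * sqrt (P $ i * Q $ i))) =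
      ln (P $ i + Q $ i) - ln 2 - (ln (P $ i) + ln (Q $ i)) / 2"
    using p q by (simp add: ln_div ln_mult ln_sqrt)
  ultimately show "(P $ i + Q $ i) / 2 * ln ((P $ i + Q $ i) / (2 * sqrt (P $ i * Q $ i))) =
      Q $ i * AG_gen (P $ i / Q $ i)"
    using p q by (simp add: AG_gen_def ln_div) (simp add: field_simps)
qed simp

text \<open>Free coefficients let one convexity argument serve both inequalities. The hypothesis on
  \<open>a\<close> and \<open>b\<close> is exactly nonnegativity of the numerator of the second
  derivative.\<close>

lemma convex_on_combination_gen:
  fixes a b :: real
  assumes "0 < r" and nonneg: "\<And>x. x \<in> {r..R} \<Longrightarrow> 0 \<le> 2 * a + b * (1 + x\<^sup>2)"
  shows "convex_on {r..R} (\<lambda>x. a * rel_AG_gen x + b * AG_gen x)"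
proof (rule f''_ge0_imp_convex)
  fix x assume x: "x \<in> {r..R}"
  then have "x > 0" using \<open>0 < r\<close> by simp
  \<comment> \<open>The factor \<open>x + 1\<close> cancels against the derivative of
    \<open>ln (x + 1)\<close>, so outside the brackets only constants and multiples of
    \<open>1 / x\<close> remain.\<close>
  show "((\<lambda>x. a * rel_AG_gen x + b * AG_gen x) has_real_derivative
      a * ((ln (x + 1) - ln 2 - ln x) / 2 - 1 / (2 * x)) +
      b * ((ln (x + 1) - ln 2 - ln x / 2) / 2 + 1 / 4 - 1 / (4 * x))) (at x)"
    unfolding rel_AG_gen_def AG_gen_def using \<open>x > 0\<close>
    by (auto intro!: derivative_eq_intros) (simp add: divide_simps, simp add: algebra_simps)
  show "((\<lambda>x. a * ((ln (x + 1) - ln 2 - ln x) / 2 - 1 / (2 * x)) +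
      b * ((ln (x + 1) - ln 2 - ln x / 2) / 2 + 1 / 4 - 1 / (4 * x))) has_real_derivative
      (2 * a + b * (1 + x\<^sup>2)) / (4 * x\<^sup>2 * (x + 1))) (at x)"
    using \<open>x > 0\<close>
    by (auto intro!: derivative_eq_intros)
       (simp add: divide_simps, simp add: algebra_simps power2_eq_square)
  show "0 \<le> (2 * a + b * (1 + x\<^sup>2)) / (4 * x\<^sup>2 * (x + 1))"
    using nonneg[OF x] \<open>x > 0\<close> by simp
qed simp

text \<open>Jensen with weights \<open>Q $ i\<close> at the points \<open>P $ i / Q $ i\<close>:
  their mean is the total mass of \<open>P\<close>, namely 1, where both generators vanish.\<close>

lemma combination_divergence_nonneg:
  fixes P Q :: "real ^ 'n" and a b :: real
  assumes P: "P \<in> prob_simplex" and Q: "Q \<in> prob_simplex" and "0 < r"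
    and ratio: "\<And>i. P $ i / Q $ i \<in> {r..R}"
    and nonneg: "\<And>x. x \<in> {r..R} \<Longrightarrow> 0 \<le> 2 * a + b * (1 + x\<^sup>2)"
  shows "0 \<le> a * rel_AG_divergence P Q + b * AG_divergence P Q"
proof -
  let ?h = "\<lambda>x. a * rel_AG_gen x + b * AG_gen x"
  have q: "Q $ i > 0" for i
    using Q by (simp add: prob_simplex_def)
  have "(\<Sum>i\<in>UNIV. Q $ i *\<^sub>R (P $ i / Q $ i)) = (\<Sum>i\<in>UNIV. P $ i)"
    using q by (intro sum.cong) (auto simp: less_imp_neq[THEN not_sym])
  then have mean: "(\<Sum>i\<in>UNIV. Q $ i *\<^sub>R (P $ i / Q $ i)) = 1"
    using P by (simp add: prob_simplex_def)
  have "?h (\<Sum>i\<in>UNIV. Q $ i *\<^sub>R (P $ i / Q $ i)) \<le> (\<Sum>i\<in>UNIV. Q $ i * ?h (P $ i / Q $ i))"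
    using Q q ratio
    by (intro convex_on_sum[OF _ _ convex_on_combination_gen[OF \<open>0 < r\<close> nonneg]])
       (auto simp: prob_simplex_def less_imp_le)
  moreover have "?h 1 = 0"
    by (simp add: rel_AG_gen_def AG_gen_def)
  ultimately have "0 \<le> (\<Sum>i\<in>UNIV. Q $ i * ?h (P $ i / Q $ i))"
    by (simp only: mean)
  also have "\<dots> = a * rel_AG_divergence P Q + b * AG_divergence P Q"
    by (simp add: rel_AG_divergence_eq_gen[OF P Q] AG_divergence_eq_gen[OF P Q]
        sum_distrib_left sum.distrib distrib_left mult.left_commute)
  finally show ?thesis .
qed

theorem proposition6p4:
  fixes P Q :: "real ^ 'n" and r R :: real
  assumes "CARD('n) \<ge> 2"
    and "P \<in> prob_simplex" and "Q \<in> prob_simplex"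
    and "0 < r"
    and "\<And>i. r \<le> P $ i / Q $ i \<and> P $ i / Q $ i \<le> R"
  shows "2 / (1 + R\<^sup>2) * AG_divergence P Q \<le> rel_AG_divergence P Q
    \<and> rel_AG_divergence P Q \<le> 2 / (1 + r\<^sup>2) * AG_divergence P Q"
proof
  have pos: "1 + y\<^sup>2 > 0" for y :: real
    by (simp add: add_pos_nonneg)
  have ratio: "P $ i / Q $ i \<in> {r..R}" for i
    using assms(5) by simp
  note nonneg = combination_divergence_nonneg[OF assms(2-4) ratio]
  \<comment> \<open>With these coefficients the sign condition reads \<open>1 + x\<^sup>2\<close>
    \<le> \<open>1 + R\<^sup>2\<close>.\<close>
  have "0 \<le> 1 * rel_AG_divergence P Q + (- (2 / (1 + R\<^sup>2))) * AG_divergence P Q"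
  proof (rule nonneg)
    fix x assume "x \<in> {r..R}"
    then have "x\<^sup>2 \<le> R\<^sup>2" using \<open>0 < r\<close> by (intro power_mono) auto
    then show "0 \<le> 2 * 1 + (- (2 / (1 + R\<^sup>2))) * (1 + x\<^sup>2)"
      using pos[of R] by (simp add: field_simps)
  qed
  then show "2 / (1 + R\<^sup>2) * AG_divergence P Q \<le> rel_AG_divergence P Q"
    by simp
  \<comment> \<open>The signs are swapped and \<open>r\<close> replaces \<open>R\<close>, so the
    condition now needs the lower bound on \<open>x\<close>.\<close>
  have "0 \<le> (- 1) * rel_AG_divergence P Q + 2 / (1 + r\<^sup>2) * AG_divergence P Q"
  proof (rule nonneg)
    fix x assume "x \<in> {r..R}"
    then have "r\<^sup>2 \<le> x\<^sup>2" using \<open>0 < r\<close> by (intro power_mono) auto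
    then show "0 \<le> 2 * (- 1) + 2 / (1 + r\<^sup>2) * (1 + x\<^sup>2)"
      using pos[of r] by (simp add: field_simps)
  qed
  then show "rel_AG_divergence P Q \<le> 2 / (1 + r\<^sup>2) * AG_divergence P Q"
    by simp
qed

end
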